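(* Let $p:=p(n)$ be such that $\frac{726\ln n}{n}\le p(n)\le \frac12$ for all sufficiently large $n$. Then with high probability, $\operatorname{tww}(G(n,p))=\Theta(n\sqrt{p})$; that is, there exist constants $c_2\ge c_1>0$ such that $\Pr\left[c_1 n\sqrt{p(n)}\le \operatorname{tww}(G(n,p(n)))\le c_2 n\sqrt{p(n)}\right]\to 1$ as $n\to\infty$.
   Context: $G(n,p)$ is the random graph on vertex set $\{1,\ldots,n\}$ in which each unordered pair of distinct vertices is adjacent with probability $p$, independently. "With high probability" means with probability tending to $1$ as $n\to\infty$. $\ln$ is the natural logarithm. All graphs are finite and simple. Twin-width. A trigraph is a triple $G=(V,B,R)$ where $B,R$ are disjoint sets of $2$-element subsets of the finite set $V$; elements of $B$ are black edges and elements of $R$ are red edges. A graph $(V,E)$ is identified with the trigraph $(V,E,\emptyset)$. The red-degree of a vertex is the number of red edges incident with it. For distinct vertices $u,v$ (not necessarily adjacent), contracting $u$ and $v$ yields the trigraph obtained by deleting $u,v$, adding a new vertex $w$, keeping all edges (with colors) among the other vertices, and for each other vertex $x$: $wx$ is a black edge if both $ux$ and $vx$ are black edges; $wx$ is a non-edge if both $ux$ and $vx$ are non-edges; and $wx$ is a red edge otherwise. A $d$-contraction sequence of $G$ is a sequence of trigraphs starting with $G$, ending with a $1$-vertex graph, each obtained from the previous one by contracting two vertices, in which all trigraphs have maximum red-degree at most $d$. The twin-width $\operatorname{tww}(G)$ is the minimum $d$ such that $G$ has a $d$-contraction sequence. *)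

theory Defs
  imports "HOL-Probability.Probability"
begin

section \<open>Trigraphs and contractions\<close>

text \<open>Vertices are natural numbers, so that a fresh vertex is always available for a contraction.\<close>

record trigraph =
  vertices :: "nat set"
  black :: "nat set set"
  red :: "nat set set"

definition pairs_on :: "nat set \<Rightarrow> nat set set" where
  "pairs_on V = {e. e \<subseteq> V \<and> card e = 2}"

definition is_trigraph :: "trigraph \<Rightarrow> bool" where
  "is_trigraph G \<longleftrightarrow> finite (vertices G) \<and> black G \<subseteq> pairs_on (vertices G) \<and>
     red G \<subseteq> pairs_on (vertices G) \<and> black G \<inter> red G = {}"

definition red_degree :: "trigraph \<Rightarrow> nat \<Rightarrow> nat" where
  "red_degree G v = card {e \<in> red G. v \<in> e}"

definition nonedge :: "trigraph \<Rightarrow> nat \<Rightarrow> nat \<Rightarrow> bool" where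
  "nonedge G u x \<longleftrightarrow> {u, x} \<notin> black G \<and> {u, x} \<notin> red G"

definition contract :: "nat \<Rightarrow> nat \<Rightarrow> nat \<Rightarrow> trigraph \<Rightarrow> trigraph" where
  "contract u v w G =
     \<lparr> vertices = insert w (vertices G - {u, v}),
       black = {e \<in> black G. u \<notin> e \<and> v \<notin> e} \<union>
         {{w, x} | x. x \<in> vertices G - {u, v} \<and> {u, x} \<in> black G \<and> {v, x} \<in> black G},
       red = {e \<in> red G. u \<notin> e \<and> v \<notin> e} \<union>
         {{w, x} | x. x \<in> vertices G - {u, v} \<and>
            \<not> ({u, x} \<in> black G \<and> {v, x} \<in> black G) \<and>
            \<not> (nonedge G u x \<and> nonedge G v x)} \<rparr>"

definition contracts_to :: "trigraph \<Rightarrow> trigraph \<Rightarrow> bool" where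
  "contracts_to G H \<longleftrightarrow> (\<exists>u v w. u \<in> vertices G \<and> v \<in> vertices G \<and> u \<noteq> v \<and>
     w \<notin> vertices G \<and> H = contract u v w G)"

definition contraction_sequence :: "nat \<Rightarrow> trigraph \<Rightarrow> trigraph list \<Rightarrow> bool" where
  "contraction_sequence d G Hs \<longleftrightarrow>
     Hs \<noteq> [] \<and> hd Hs = G \<and> card (vertices (last Hs)) = 1 \<and>
     (\<forall>i. Suc i < length Hs \<longrightarrow> contracts_to (Hs ! i) (Hs ! Suc i)) \<and>
     (\<forall>H \<in> set Hs. \<forall>v \<in> vertices H. red_degree H v \<le> d)"

definition tww_trigraph :: "trigraph \<Rightarrow> nat" where
  "tww_trigraph G = (LEAST d. \<exists>Hs. contraction_sequence d G Hs)"

lemma is_trigraph_contract: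
  assumes G: "is_trigraph G" and w: "w \<notin> vertices G"
  shows "is_trigraph (contract u v w G)"
proof -
  have sub: "\<And>e. e \<in> black G \<union> red G \<Longrightarrow> e \<subseteq> vertices G \<and> card e = 2"
    using G by (auto simp: is_trigraph_def pairs_on_def)
  have wx: "{w, x} \<in> pairs_on (insert w (vertices G - {u, v}))"
    if "x \<in> vertices G - {u, v}" for x
    using that w by (auto simp: pairs_on_def card_insert_if)
  have old: "e \<in> pairs_on (insert w (vertices G - {u, v}))" "w \<notin> e"
    if "e \<in> black G \<union> red G" "u \<notin> e" "v \<notin> e" for e
    using sub[OF that(1)] that(2,3) w by (auto simp: pairs_on_def)
  have disj: "black G \<inter> red G = {}" and fin: "finite (vertices G)"
    using G by (auto simp: is_trigraph_def)
  have eq: "x = y" if "{w, x} = {w, y}" for x y using that by (auto simp: doubleton_eq_iff)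
  have "black (contract u v w G) \<inter> red (contract u v w G) = {}"
  proof (intro equals0I)
    fix e assume e: "e \<in> black (contract u v w G) \<inter> red (contract u v w G)"
    show False
    proof (cases "w \<in> e")
      case True
      then have "e \<notin> black G \<union> red G" using sub w by blast
      with e obtain x y where "e = {w, x}" "e = {w, y}" "{u, x} \<in> black G \<and> {v, x} \<in> black G"
        "\<not> ({u, y} \<in> black G \<and> {v, y} \<in> black G)"
        unfolding contract_def by auto
      then show False using eq by metis
    next
      case False
      then show False using e disj unfolding contract_def by auto
    qed
  qed
  moreover have "black (contract u v w G) \<subseteq> pairs_on (insert w (vertices G - {u, v}))"
    using wx old(1) by (auto simp: contract_def)
  moreover have "red (contract u v w G) \<subseteq> pairs_on (insert w (vertices G - {u, v}))"
    using wx old(1) by (auto simp: contract_def)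
  ultimately show ?thesis
    using fin by (simp add: is_trigraph_def) (simp add: contract_def)
qed

lemma contraction_sequence_exists:
  assumes "is_trigraph G" "vertices G \<noteq> {}"
  shows "\<exists>d Hs. contraction_sequence d G Hs"
  using assms
proof (induction "card (vertices G)" arbitrary: G rule: less_induct)
  case less
  have fin: "finite (vertices G)" using less.prems by (simp add: is_trigraph_def)
  show ?case
  proof (cases "card (vertices G) = 1")
    case True
    have "contraction_sequence (\<Sum>v\<in>vertices G. red_degree G v) G [G]"
      using True fin by (auto simp: contraction_sequence_def intro!: member_le_sum)
    then show ?thesis by blast
  next
    case False
    obtain u where u: "u \<in> vertices G" using less.prems by blast
    have "vertices G \<noteq> {u}" using False by auto
    then obtain v where v: "v \<in> vertices G" "v \<noteq> u" using u by blast
    obtain w where w: "w \<notin> vertices G" using fin ex_new_if_finite infinite_UNIV_nat by blast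
    define H where "H = contract u v w G"
    have H: "is_trigraph H" using less.prems(1) w by (simp add: H_def is_trigraph_contract)
    have vH: "vertices H = insert w (vertices G - {u, v})" by (simp add: H_def contract_def)
    have "card {u, v} \<le> card (vertices G)" using u v fin by (intro card_mono) auto
    then have "card (vertices H) < card (vertices G)"
      using u v w fin by (simp add: vH card_Diff_subset)
    from less.hyps[OF this H] vH obtain d Hs where Hs: "contraction_sequence d H Hs" by auto
    have GH: "contracts_to G H" using u v w H_def by (auto simp: contracts_to_def)
    let ?d = "max d (\<Sum>v\<in>vertices G. red_degree G v)"
    have "red_degree G x \<le> ?d" if "x \<in> vertices G" for x
      using member_le_sum[OF that, of "red_degree G"] fin by (simp add: max_def)
    moreover have "contracts_to ((G # Hs) ! i) ((G # Hs) ! Suc i)" if "Suc i < length (G # Hs)" for i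
      using that Hs GH by (cases i) (auto simp: contraction_sequence_def hd_conv_nth)
    moreover have "\<forall>K \<in> set Hs. \<forall>x \<in> vertices K. red_degree K x \<le> ?d"
      using Hs by (auto simp: contraction_sequence_def le_max_iff_disj)
    ultimately have "contraction_sequence ?d G (G # Hs)"
      using Hs by (auto simp: contraction_sequence_def)
    then show ?thesis by blast
  qed
qed

section \<open>Graphs and the random graph\<close>

type_synonym graph = "nat set \<times> nat set set"

definition trigraph_of :: "graph \<Rightarrow> trigraph" where
  "trigraph_of G = \<lparr> vertices = fst G, black = snd G, red = {} \<rparr>"

definition tww :: "graph \<Rightarrow> nat" where
  "tww G = tww_trigraph (trigraph_of G)"

text \<open>One independent coin per unordered pair of distinct vertices. Outside the unit interval
  \<^const>\<open>bernoulli_pmf\<close> clamps its parameter.\<close>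

definition gnp :: "nat \<Rightarrow> real \<Rightarrow> graph pmf" where
  "gnp n p = map_pmf (\<lambda>X. ({1..n}, {e \<in> pairs_on {1..n}. X e}))
     (Pi_pmf (pairs_on {1..n}) False (\<lambda>_. bernoulli_pmf p))"

end

theory Submission
  imports Defs
begin

text \<open>
  Every trigraph in a contraction sequence of a graph \<open>(V, E)\<close> is the quotient of the graph by a
  partition of \<open>V\<close>: two parts are joined by a black edge if all pairs between them are edges, by no
  edge if none is, and by a red edge if the pairs are mixed (\<open>contract_quotient\<close>). So the theorem is a
  statement about sequences of partitions, each merging two parts of the one before. The critical
  size of a part is \<open>t = 1 / sqrt p\<close>: two parts of this size have about one edge between them, so
  they are mixed with probability bounded away from 0, and a partition into such parts has
  about \<open>n / t = n sqrt p\<close> of them.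

  Upper bound. With high probability all degrees are at most \<open>4 n p\<close>. Cut \<open>V\<close> into blocks of size about
  \<open>t\<close> and contract within the blocks. Each red edge at a part contains an edge of the graph that
  leaves the part, so a part inside a block has red degree at most \<open>t 4 n p\<close>, which is of order
  \<open>n sqrt p\<close>. Afterwards only about \<open>n sqrt p\<close> vertices are left, and contracting them in any order
  keeps the red degrees below their number (\<open>tww_le_of_max_degree\<close>).

  Lower bound. Call a part big if its size is at least \<open>t\<close>. In any contraction sequence, stop when the
  big parts first cover a quarter of \<open>V\<close>. One contraction adds at most \<open>2 t\<close> vertices to this
  cover, so at that moment the small parts still cover at least half of \<open>V\<close> (\<open>tww_balanced_quotient\<close>). There
  are thus of order \<open>n^2\<close> pairs of vertices between big and small parts. For a fixed partition of
  this kind, the events that two given parts are mixed are independent for distinct pairs of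
  parts, and parts of sizes \<open>a\<close> and \<open>b\<close> with at least two pairs between them fail to be mixed with
  probability at most \<open>exp (- p a b / 2)\<close>. An exponential moment with a weight proportional to \<open>a\<close>
  for a big part of size \<open>a\<close> shows that all big parts have red degree at most \<open>n sqrt p / 32\<close> with
  probability at most \<open>exp (- p n^2 / 64)\<close> (\<open>prob_quotient_low_red_degree\<close>). This beats the number
  \<open>n ^ n = exp (n ln n)\<close> of labelled partitions as soon as \<open>n p\<close> is a large enough multiple of \<open>ln n\<close>.
\<close>

section \<open>Quotient trigraphs\<close>

text \<open>A partition of \<open>V\<close> is given by a labelling \<open>f\<close>, whose fibers are the parts. The labels are
  the vertex names of the quotient, so the arbitrary fresh name of a contraction is a new label.\<close>

definition fiber :: "(nat \<Rightarrow> nat) \<Rightarrow> nat set \<Rightarrow> nat \<Rightarrow> nat set" where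
  "fiber f V x = {a \<in> V. f a = x}"

definition cross :: "(nat \<Rightarrow> nat) \<Rightarrow> nat set \<Rightarrow> nat \<Rightarrow> nat \<Rightarrow> nat set set" where
  "cross f V x y = {{a, b} | a b. a \<in> fiber f V x \<and> b \<in> fiber f V y}"

definition mixed :: "nat set set \<Rightarrow> nat set set \<Rightarrow> bool" where
  "mixed E C \<longleftrightarrow> \<not> C \<subseteq> E \<and> C \<inter> E \<noteq> {}"

text \<open>All parts are nonempty, so of the three conditions on the pairs between two parts, all edges,
  no edges and mixed, exactly one holds.\<close>

definition quotient_trigraph :: "(nat \<Rightarrow> nat) \<Rightarrow> nat set \<Rightarrow> nat set set \<Rightarrow> trigraph" where
  "quotient_trigraph f V E = \<lparr> vertices = f ` V,
     black = {{x, y} | x y. x \<in> f ` V \<and> y \<in> f ` V \<and> x \<noteq> y \<and> cross f V x y \<subseteq> E},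
     red = {{x, y} | x y. x \<in> f ` V \<and> y \<in> f ` V \<and> x \<noteq> y \<and> mixed E (cross f V x y)} \<rparr>"

definition merge_labels :: "nat \<Rightarrow> nat \<Rightarrow> nat \<Rightarrow> (nat \<Rightarrow> nat) \<Rightarrow> nat \<Rightarrow> nat" where
  "merge_labels u v w f a = (if f a \<in> {u, v} then w else f a)"

lemma cross_commute: "cross f V x y = cross f V y x"
  unfolding cross_def by (auto simp: insert_commute)

lemma cross_nonempty: "x \<in> f ` V \<Longrightarrow> y \<in> f ` V \<Longrightarrow> cross f V x y \<noteq> {}"
  by (auto simp: cross_def fiber_def)

lemma vertices_quotient [simp]: "vertices (quotient_trigraph f V E) = f ` V"
  by (simp add: quotient_trigraph_def)

lemma black_quotient:
  assumes "x \<in> f ` V" "y \<in> f ` V" "x \<noteq> y"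
  shows "{x, y} \<in> black (quotient_trigraph f V E) \<longleftrightarrow> cross f V x y \<subseteq> E"
proof
  assume "{x, y} \<in> black (quotient_trigraph f V E)"
  then obtain x' y' where "{x, y} = {x', y'}" "cross f V x' y' \<subseteq> E"
    by (auto simp: quotient_trigraph_def)
  then show "cross f V x y \<subseteq> E" using cross_commute by (metis doubleton_eq_iff)
next
  assume "cross f V x y \<subseteq> E"
  then show "{x, y} \<in> black (quotient_trigraph f V E)" using assms by (auto simp: quotient_trigraph_def)
qed

lemma red_quotient:
  assumes "x \<in> f ` V" "y \<in> f ` V" "x \<noteq> y"
  shows "{x, y} \<in> red (quotient_trigraph f V E) \<longleftrightarrow> mixed E (cross f V x y)"
proof
  assume "{x, y} \<in> red (quotient_trigraph f V E)"
  then obtain x' y' where "{x, y} = {x', y'}" "mixed E (cross f V x' y')"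
    by (auto simp: quotient_trigraph_def)
  then show "mixed E (cross f V x y)" using cross_commute by (metis doubleton_eq_iff)
next
  assume "mixed E (cross f V x y)"
  then show "{x, y} \<in> red (quotient_trigraph f V E)" using assms by (auto simp: quotient_trigraph_def)
qed

lemma nonedge_quotient:
  assumes "x \<in> f ` V" "y \<in> f ` V" "x \<noteq> y"
  shows "nonedge (quotient_trigraph f V E) x y \<longleftrightarrow> cross f V x y \<inter> E = {}"
  using cross_nonempty[OF assms(1,2)]
  by (auto simp: nonedge_def black_quotient[OF assms] red_quotient[OF assms] mixed_def)

lemma is_trigraph_quotient:
  assumes "finite V" shows "is_trigraph (quotient_trigraph f V E)"
proof -
  have "black (quotient_trigraph f V E) \<inter> red (quotient_trigraph f V E) = {}"
  proof (intro equals0I)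
    fix e assume e: "e \<in> black (quotient_trigraph f V E) \<inter> red (quotient_trigraph f V E)"
    then obtain x y where "x \<in> f ` V" "y \<in> f ` V" "x \<noteq> y" "e = {x, y}"
      by (auto simp: quotient_trigraph_def)
    with e show False by (auto simp: black_quotient red_quotient mixed_def)
  qed
  then show ?thesis
    using assms by (auto simp: is_trigraph_def pairs_on_def) (auto simp: quotient_trigraph_def)
qed

lemma trigraph_eqI:
  assumes "is_trigraph G" "is_trigraph H" "vertices G = vertices H"
    and b: "\<And>x y. x \<in> vertices G \<Longrightarrow> y \<in> vertices G \<Longrightarrow> x \<noteq> y \<Longrightarrow>
      {x, y} \<in> black G \<longleftrightarrow> {x, y} \<in> black H"
    and r: "\<And>x y. x \<in> vertices G \<Longrightarrow> y \<in> vertices G \<Longrightarrow> x \<noteq> y \<Longrightarrow>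
      {x, y} \<in> red G \<longleftrightarrow> {x, y} \<in> red H"
  shows "G = H"
proof -
  have *: "\<exists>x y. e = {x, y} \<and> x \<in> vertices G \<and> y \<in> vertices G \<and> x \<noteq> y"
    if "e \<in> black G \<union> red G \<union> black H \<union> red H" for e
  proof -
    have "e \<subseteq> vertices G" "card e = 2"
      using that assms(1-3) by (auto simp: is_trigraph_def pairs_on_def)
    then show ?thesis by (auto simp: card_2_iff)
  qed
  have "black G = black H" "red G = red H"
    using * b r by (blast, blast)
  then show ?thesis using assms(3) by simp
qed

lemma trigraph_of_eq_quotient:
  assumes "finite V" "E \<subseteq> pairs_on V"
  shows "trigraph_of (V, E) = quotient_trigraph id V E"
proof (rule trigraph_eqI)
  show "is_trigraph (trigraph_of (V, E))"
    using assms by (auto simp: is_trigraph_def trigraph_of_def)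
  fix x y assume "x \<in> vertices (trigraph_of (V, E))" "y \<in> vertices (trigraph_of (V, E))" "x \<noteq> y"
  then have xy: "x \<in> id ` V" "y \<in> id ` V" "x \<noteq> y" by (auto simp: trigraph_of_def)
  have "cross id V x y = {{x, y}}" using xy by (auto simp: cross_def fiber_def)
  then show "{x, y} \<in> black (trigraph_of (V, E)) \<longleftrightarrow> {x, y} \<in> black (quotient_trigraph id V E)"
    and "{x, y} \<in> red (trigraph_of (V, E)) \<longleftrightarrow> {x, y} \<in> red (quotient_trigraph id V E)"
    unfolding black_quotient[OF xy] red_quotient[OF xy] by (auto simp: trigraph_of_def mixed_def)
qed (use assms in \<open>auto simp: is_trigraph_quotient trigraph_of_def\<close>)

lemma merge_image:
  assumes "u \<in> f ` V" "v \<in> f ` V"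
  shows "merge_labels u v w f ` V = insert w (f ` V - {u, v})"
  using assms by (auto simp: merge_labels_def image_iff)

lemma fiber_merge:
  assumes "w \<notin> f ` V"
  shows "fiber (merge_labels u v w f) V w = fiber f V u \<union> fiber f V v"
    and "x \<noteq> w \<Longrightarrow> x \<noteq> u \<Longrightarrow> x \<noteq> v \<Longrightarrow> fiber (merge_labels u v w f) V x = fiber f V x"
  using assms by (auto simp: fiber_def merge_labels_def)

text \<open>The pairs between the merged part and another part are the union of the two old families, and
  the colour rule of a contraction is the rule for how all, none and mixed behave under union.\<close>

lemma contract_quotient:
  assumes V: "finite V" and u: "u \<in> f ` V" and v: "v \<in> f ` V" and w: "w \<notin> f ` V"
  shows "contract u v w (quotient_trigraph f V E) = quotient_trigraph (merge_labels u v w f) V E" (is "?G = ?H")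
proof (rule trigraph_eqI)
  let ?f = "merge_labels u v w f"
  note im = merge_image[OF u v, of w]
  show "is_trigraph ?G" using w V by (simp add: is_trigraph_contract is_trigraph_quotient)
  show "is_trigraph ?H" using V by (rule is_trigraph_quotient)
  show vert: "vertices ?G = vertices ?H" by (simp add: im) (simp add: contract_def)
  have new: "({w, x} \<in> black ?G \<longleftrightarrow> {w, x} \<in> black ?H) \<and> ({w, x} \<in> red ?G \<longleftrightarrow> {w, x} \<in> red ?H)"
    if x: "x \<in> f ` V - {u, v}" for x
  proof -
    have wx: "w \<noteq> x" using x w by auto
    have H: "w \<in> ?f ` V" "x \<in> ?f ` V" using x by (auto simp: im)
    have ux: "u \<in> f ` V" "x \<in> f ` V" "u \<noteq> x" and vx: "v \<in> f ` V" "x \<in> f ` V" "v \<noteq> x"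
      using u v x by auto
    have c: "cross ?f V w x = cross f V u x \<union> cross f V v x"
      using fiber_merge(2)[OF w, of x u v] fiber_merge(1)[OF w, of u v] x wx
      by (auto simp: cross_def)
    have no: "{w, x} \<notin> black (quotient_trigraph f V E)" "{w, x} \<notin> red (quotient_trigraph f V E)"
      using w by (auto simp: quotient_trigraph_def doubleton_eq_iff)
    have "{w, x} \<in> black ?G \<longleftrightarrow>
      {u, x} \<in> black (quotient_trigraph f V E) \<and> {v, x} \<in> black (quotient_trigraph f V E)"
      using x wx no by (auto simp: contract_def doubleton_eq_iff)
    moreover have "{w, x} \<in> red ?G \<longleftrightarrow>
      \<not> ({u, x} \<in> black (quotient_trigraph f V E) \<and> {v, x} \<in> black (quotient_trigraph f V E)) \<and>
      \<not> (nonedge (quotient_trigraph f V E) u x \<and> nonedge (quotient_trigraph f V E) v x)"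
      using x wx no by (auto simp: contract_def doubleton_eq_iff)
    ultimately show ?thesis
      unfolding black_quotient[OF H wx] red_quotient[OF H wx] black_quotient[OF ux]
        black_quotient[OF vx] nonedge_quotient[OF ux] nonedge_quotient[OF vx] c mixed_def
      by blast
  qed
  have old: "({x, y} \<in> black ?G \<longleftrightarrow> {x, y} \<in> black ?H) \<and> ({x, y} \<in> red ?G \<longleftrightarrow> {x, y} \<in> red ?H)"
    if x: "x \<in> f ` V - {u, v}" and y: "y \<in> f ` V - {u, v}" and xy: "x \<noteq> y" for x y
  proof -
    have w': "w \<noteq> x" "w \<noteq> y" using x y w by auto
    have H: "x \<in> ?f ` V" "y \<in> ?f ` V" using x y by (auto simp: im)
    have G: "x \<in> f ` V" "y \<in> f ` V" using x y by auto
    have c: "cross ?f V x y = cross f V x y"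
      using fiber_merge(2)[OF w, of x u v] fiber_merge(2)[OF w, of y u v] x y w'
      by (auto simp: cross_def)
    have "{x, y} \<in> black ?G \<longleftrightarrow> {x, y} \<in> black (quotient_trigraph f V E)"
      "{x, y} \<in> red ?G \<longleftrightarrow> {x, y} \<in> red (quotient_trigraph f V E)"
      using x y w' by (auto simp: contract_def doubleton_eq_iff)
    then show ?thesis
      unfolding black_quotient[OF H xy] red_quotient[OF H xy] black_quotient[OF G xy]
        red_quotient[OF G xy] c by simp
  qed
  fix x y assume "x \<in> vertices ?G" "y \<in> vertices ?G" and xy: "x \<noteq> y"
  then have xy': "x \<in> insert w (f ` V - {u, v})" "y \<in> insert w (f ` V - {u, v})"
    by (simp_all add: vert im)
  show "{x, y} \<in> black ?G \<longleftrightarrow> {x, y} \<in> black ?H" "{x, y} \<in> red ?G \<longleftrightarrow> {x, y} \<in> red ?H"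
    using xy xy' new[of x] new[of y] old[of x y] by (auto simp: insert_commute)
qed

lemma red_quotientE:
  assumes "e \<in> red (quotient_trigraph f V E)" "x \<in> e"
  obtains y where "e = {x, y}" "y \<in> f ` V" "y \<noteq> x" "mixed E (cross f V x y)"
proof -
  obtain u v where uv: "e = {u, v}" "u \<in> f ` V" "v \<in> f ` V" "u \<noteq> v" "mixed E (cross f V u v)"
    using assms(1) unfolding quotient_trigraph_def by auto
  show ?thesis
  proof (cases "x = u")
    case True
    then show ?thesis using uv that[of v] by simp
  next
    case False
    then have "x = v" using assms(2) uv(1) by simp
    then show ?thesis using uv that[of u] cross_commute[of f V u v] by (simp add: insert_commute)
  qed
qed

lemma red_degree_quotient:
  assumes x: "x \<in> f ` V" and "finite V"
  shows "red_degree (quotient_trigraph f V E) x = card {y \<in> f ` V. y \<noteq> x \<and> mixed E (cross f V x y)}"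
proof -
  have "{e \<in> red (quotient_trigraph f V E). x \<in> e} =
      (\<lambda>y. {x, y}) ` {y \<in> f ` V. y \<noteq> x \<and> mixed E (cross f V x y)}" (is "?L = ?R")
  proof (intro equalityI subsetI)
    fix e assume e: "e \<in> ?L"
    then show "e \<in> ?R" by (auto elim!: red_quotientE)
  next
    fix e assume "e \<in> ?R"
    then show "e \<in> ?L" using x by (auto simp: red_quotient)
  qed
  moreover have "inj_on (\<lambda>y. {x, y}) A" for A
    by (auto simp: inj_on_def doubleton_eq_iff)
  ultimately show ?thesis by (simp add: red_degree_def card_image)
qed

section \<open>Upper bound from the maximum degree\<close>

lemma contraction_sequence_Cons:
  assumes "contracts_to G H" "contraction_sequence d H Hs"
    and "\<And>v. v \<in> vertices G \<Longrightarrow> red_degree G v \<le> d"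
  shows "contraction_sequence d G (G # Hs)"
proof -
  have "contracts_to ((G # Hs) ! i) ((G # Hs) ! Suc i)" if "Suc i < length (G # Hs)" for i
    using that assms(1,2) by (cases i) (auto simp: contraction_sequence_def hd_conv_nth)
  then show ?thesis using assms(2,3) by (auto simp: contraction_sequence_def)
qed

lemma red_degree_quotient_le_card:
  assumes "finite V" "x \<in> f ` V"
  shows "red_degree (quotient_trigraph f V E) x \<le> card (f ` V) - 1"
proof -
  have "card {y \<in> f ` V. y \<noteq> x \<and> mixed E (cross f V x y)} \<le> card (f ` V - {x})"
    using assms by (intro card_mono) auto
  then show ?thesis using assms by (simp add: red_degree_quotient)
qed

text \<open>A red edge at \<open>x\<close> is the image of some edge of the graph with an end in the fiber of \<open>x\<close>, and the
  fiber meets few edges.\<close>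

lemma red_degree_quotient_le_edges:
  assumes V: "finite V" and E: "finite E" and x: "x \<in> f ` V"
    and deg: "\<And>a. a \<in> V \<Longrightarrow> card {e \<in> E. a \<in> e} \<le> \<Delta>"
  shows "red_degree (quotient_trigraph f V E) x \<le> card (fiber f V x) * \<Delta>"
proof -
  let ?S = "\<Union>a\<in>fiber f V x. {e \<in> E. a \<in> e}"
  have fin: "finite ?S" "finite (fiber f V x)" using V E by (auto simp: fiber_def)
  have "{e \<in> red (quotient_trigraph f V E). x \<in> e} \<subseteq> (\<lambda>e. f ` e) ` ?S"
  proof
    fix e assume e: "e \<in> {e \<in> red (quotient_trigraph f V E). x \<in> e}"
    then obtain y where y: "e = {x, y}" and "mixed E (cross f V x y)"
      by (auto elim!: red_quotientE)
    from this(2) obtain a b where "a \<in> fiber f V x" "b \<in> fiber f V y" "{a, b} \<in> E"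
      by (auto simp: mixed_def cross_def)
    then have "{a, b} \<in> ?S" "f ` {a, b} = e" using y by (auto simp: fiber_def)
    then show "e \<in> (\<lambda>e. f ` e) ` ?S" by blast
  qed
  then have "red_degree (quotient_trigraph f V E) x \<le> card ((\<lambda>e. f ` e) ` ?S)"
    unfolding red_degree_def using fin by (intro card_mono) auto
  also have "\<dots> \<le> card ?S" using fin by (intro card_image_le)
  also have "\<dots> \<le> (\<Sum>a\<in>fiber f V x. card {e \<in> E. a \<in> e})" using fin(2) by (rule card_UN_le)
  also have "\<dots> \<le> card (fiber f V x) * \<Delta>"
    using deg sum_bounded_above[of "fiber f V x" "\<lambda>a. card {e \<in> E. a \<in> e}" \<Delta>]
    by (auto simp: fiber_def)
  finally show ?thesis .
qed

text \<open>The greedy strategy: while there are more than \<open>d + 1\<close> parts, the pigeonhole principle provides two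
  parts in the same group, and merging them keeps all parts within groups, so of size at most \<open>s\<close>.
  Once there are at most \<open>d + 1\<close> parts, every trigraph has red degree at most \<open>d\<close> and any merge will
  do. The refinement hypothesis is conditional on the number of parts so that one induction
  covers both phases.\<close>

lemma contraction_sequence_by_groups:
  assumes V: "finite V" "V \<noteq> {}" and E: "finite E"
    and deg: "\<And>a. a \<in> V \<Longrightarrow> card {e \<in> E. a \<in> e} \<le> \<Delta>"
    and size: "\<And>g. card (fiber grp V g) \<le> s"
    and d: "s * \<Delta> \<le> d" "card (grp ` V) \<le> Suc d"
    and refines: "card (f ` V) > Suc d \<Longrightarrow> \<forall>a\<in>V. \<forall>b\<in>V. f a = f b \<longrightarrow> grp a = grp b"
  shows "\<exists>Hs. contraction_sequence d (quotient_trigraph f V E) Hs"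
  using refines
proof (induction "card (f ` V)" arbitrary: f rule: less_induct)
  case less
  have fin: "finite (f ` V)" using V by simp
  have red: "red_degree (quotient_trigraph f V E) x \<le> d" if x: "x \<in> vertices (quotient_trigraph f V E)" for x
  proof (cases "card (f ` V) \<le> Suc d")
    case True
    then show ?thesis using red_degree_quotient_le_card[of V x f E] V x by simp
  next
    case False
    obtain a where a: "a \<in> V" "f a = x" using x by auto
    have ref: "\<forall>b\<in>V. \<forall>c\<in>V. f b = f c \<longrightarrow> grp b = grp c"
      using False by (intro less.prems) simp
    have "grp b = grp a" if "b \<in> V" "f b = x" for b
      using ref[rule_format, of b a] that a by simp
    then have "fiber f V x \<subseteq> fiber grp V (grp a)"
      by (auto simp: fiber_def)
    then have "card (fiber f V x) \<le> s"
      using size[of "grp a"] card_mono[of "fiber grp V (grp a)" "fiber f V x"] V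
      by (auto simp: fiber_def)
    moreover have "red_degree (quotient_trigraph f V E) x \<le> card (fiber f V x) * \<Delta>"
      using x V E deg by (intro red_degree_quotient_le_edges) auto
    ultimately show ?thesis using d(1) by (meson le_trans mult_le_mono1)
  qed
  show ?case
  proof (cases "card (f ` V) = 1")
    case True
    have "contraction_sequence d (quotient_trigraph f V E) [quotient_trigraph f V E]"
      using True red by (auto simp: contraction_sequence_def)
    then show ?thesis by blast
  next
    case False
    then have card2: "2 \<le> card (f ` V)" using V fin
      by (metis One_nat_def Suc_1 Suc_leI card_gt_0_iff image_is_empty le_neq_implies_less)
    obtain a b where ab: "a \<in> V" "b \<in> V" "f a \<noteq> f b"
      "card (f ` V) > Suc d \<Longrightarrow> grp a = grp b"
    proof (cases "card (f ` V) > Suc d")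
      case True
      have "\<exists>a\<in>V. \<exists>b\<in>V. f a \<noteq> f b \<and> grp a = grp b"
      proof (rule ccontr)
        assume no: "\<not> ?thesis"
        \<comment> \<open>Then the group of a vertex determines its part, through \<open>?h\<close>.\<close>
        let ?h = "\<lambda>g. f (inv_into V grp g)"
        have "f ` V \<subseteq> ?h ` (grp ` V)"
        proof
          fix x assume "x \<in> f ` V"
          then obtain a where a: "a \<in> V" "x = f a" by auto
          have "inv_into V grp (grp a) \<in> V" "grp (inv_into V grp (grp a)) = grp a"
            using a by (auto simp: inv_into_into f_inv_into_f)
          then have "f (inv_into V grp (grp a)) = f a" using no a by auto
          then show "x \<in> ?h ` (grp ` V)" using a by (metis image_eqI)
        qed
        then have "card (f ` V) \<le> card (grp ` V)"
          using V by (meson card_image_le card_mono finite_imageI le_trans)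
        then show False using True d(2) by simp
      qed
      then show ?thesis using that by blast
    next
      case False
      have "\<not> card (f ` V) \<le> Suc 0" using card2 by simp
      then obtain a b where "a \<in> V" "b \<in> V" "f a \<noteq> f b"
        unfolding card_le_Suc0_iff_eq[OF fin] by blast
      then show ?thesis using that False by simp
    qed
    obtain w where w: "w \<notin> f ` V" using fin ex_new_if_finite infinite_UNIV_nat by blast
    let ?f = "merge_labels (f a) (f b) w f"
    have H: "contract (f a) (f b) w (quotient_trigraph f V E) = quotient_trigraph ?f V E"
      using V ab w by (intro contract_quotient) auto
    have "card (?f ` V) \<le> Suc (card (f ` V - {f a, f b}))"
      using ab merge_image[of "f a" f V "f b" w] fin by (simp add: card_insert_if)
    also have "\<dots> < card (f ` V)"
      using ab card2 fin by (simp add: card_Diff_subset)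
    finally have smaller: "card (?f ` V) < card (f ` V)" .
    have "\<forall>c\<in>V. \<forall>c'\<in>V. ?f c = ?f c' \<longrightarrow> grp c = grp c'" if "card (?f ` V) > Suc d"
    proof -
      have big: "card (f ` V) > Suc d" using that smaller by simp
      have ref: "\<forall>c\<in>V. \<forall>c'\<in>V. f c = f c' \<longrightarrow> grp c = grp c'" using big by (rule less.prems)
      show ?thesis
      proof (intro ballI impI)
        fix c c' assume c: "c \<in> V" "c' \<in> V" "?f c = ?f c'"
        have new: "f z \<noteq> w" if "z \<in> V" for z using w that by auto
        have "f c = f c' \<or> {f c, f c'} \<subseteq> {f a, f b}"
          using c new[OF c(1)] new[OF c(2)] by (auto simp: merge_labels_def split: if_splits)
        then show "grp c = grp c'"
        proof
          assume "f c = f c'" then show ?thesis using ref[rule_format, OF c(1,2)] by simp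
        next
          assume *: "{f c, f c'} \<subseteq> {f a, f b}"
          have "grp z = grp a" if z: "z \<in> V" "f z \<in> {f a, f b}" for z
          proof (cases "f z = f a")
            case True then show ?thesis using ref[rule_format, of z a] z ab(1) by simp
          next
            case False
            then have "grp z = grp b" using ref[rule_format, of z b] z ab(2) by simp
            then show ?thesis using ab(4)[OF big] by simp
          qed
          from this[of c] this[of c'] show ?thesis using * c(1,2) by simp
        qed
      qed
    qed
    from less.hyps[OF smaller this] obtain Hs where
      Hs: "contraction_sequence d (quotient_trigraph ?f V E) Hs" by blast
    have "contracts_to (quotient_trigraph f V E) (quotient_trigraph ?f V E)"
      unfolding contracts_to_def using ab w H[symmetric]
      by (intro exI[of _ "f a"] exI[of _ "f b"] exI[of _ w]) auto
    from contraction_sequence_Cons[OF this Hs red] show ?thesis by blast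
  qed
qed

text \<open>The groups are runs of at most \<open>s\<close> consecutive vertices. There are at most \<open>n div s + 1\<close> of them, and
  a trigraph with so many vertices has red degree at most \<open>n div s\<close>.\<close>

lemma tww_le_of_max_degree:
  assumes n: "n > 0" and s: "s > 0" and E: "E \<subseteq> pairs_on {1..n}"
    and deg: "\<And>a. a \<in> {1..n} \<Longrightarrow> card {e \<in> E. a \<in> e} \<le> \<Delta>"
  shows "tww ({1..n}, E) \<le> max (s * \<Delta>) (n div s)"
proof -
  let ?V = "{1..n}" and ?grp = "\<lambda>a. a div s"
  have "card (fiber ?grp ?V g) \<le> s" for g
  proof -
    have "fiber ?grp ?V g \<subseteq> {g * s..<g * s + s}"
    proof
      fix a assume "a \<in> fiber ?grp ?V g"
      then have "a div s = g" by (simp add: fiber_def)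
      then show "a \<in> {g * s..<g * s + s}"
        using s div_mult_mod_eq[of a s] mod_less_divisor[OF s, of a] by auto
    qed
    then show ?thesis using card_mono[of "{g * s..<g * s + s}"] by simp
  qed
  moreover have "card (?grp ` ?V) \<le> Suc (n div s)"
    using card_mono[of "{..n div s}" "?grp ` ?V"] by (force intro: div_le_mono)
  moreover have "finite E"
    using E by (rule finite_subset) (simp add: pairs_on_def)
  ultimately have "\<exists>Hs. contraction_sequence (max (s * \<Delta>) (n div s)) (quotient_trigraph id ?V E) Hs"
    using n deg by (intro contraction_sequence_by_groups[where grp = ?grp and s = s and \<Delta> = \<Delta>]) auto
  then show ?thesis
    using E by (simp add: tww_def tww_trigraph_def trigraph_of_eq_quotient Least_le)
qed

section \<open>Balanced quotients in contraction sequences\<close>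

definition big_part :: "real \<Rightarrow> (nat \<Rightarrow> nat) \<Rightarrow> nat set \<Rightarrow> nat set" where
  "big_part t f V = {a \<in> V. t \<le> card (fiber f V (f a))}"

text \<open>Only vertices of the two merged parts can become covered by big parts, and of these only the ones
  whose part was small, of size below \<open>t\<close>.\<close>

lemma card_big_part_merge:
  fixes t :: real
  assumes V: "finite V" and w: "w \<notin> f ` V" and t: "0 \<le> t"
  shows "card (big_part t (merge_labels u v w f) V) \<le> card (big_part t f V) + 2 * t"
proof -
  let ?small = "\<lambda>x. if card (fiber f V x) < t then fiber f V x else {}"
  have fin: "finite (fiber f V x)" "finite (?small x)" "finite (big_part t f V)" for x
    using V by (auto simp: fiber_def big_part_def)
  have card_small: "card (?small x) \<le> t" for x using t by simp
  have "big_part t (merge_labels u v w f) V \<subseteq> big_part t f V \<union> (?small u \<union> ?small v)"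
  proof
    fix a assume a: "a \<in> big_part t (merge_labels u v w f) V"
    then have aV: "a \<in> V" by (simp add: big_part_def)
    show "a \<in> big_part t f V \<union> (?small u \<union> ?small v)"
    proof (cases "f a \<in> {u, v}")
      case True
      then show ?thesis using aV by (auto simp: big_part_def fiber_def)
    next
      case False
      moreover have "f a \<noteq> w" using w aV by auto
      ultimately have "fiber (merge_labels u v w f) V (merge_labels u v w f a) = fiber f V (f a)"
        using fiber_merge(2)[OF w, of "f a" u v] by (simp add: merge_labels_def)
      then show ?thesis using a by (simp add: big_part_def)
    qed
  qed
  then have "card (big_part t (merge_labels u v w f) V) \<le>
      card (big_part t f V \<union> (?small u \<union> ?small v))"
    using fin by (intro card_mono) simp_all
  also have "\<dots> \<le> card (big_part t f V) + (card (?small u) + card (?small v))"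
    by (meson card_Un_le le_trans nat_add_left_cancel_le)
  finally show ?thesis using card_small[of u] card_small[of v] by linarith
qed

text \<open>A discrete intermediate value argument: the cover by big parts starts below \<open>m\<close>, ends as all of
  \<open>V\<close>, and grows by at most \<open>2 t\<close> in a step, so the first quotient where it reaches \<open>m\<close> will do.\<close>

lemma contraction_sequence_balanced_quotient:
  fixes t m :: real
  assumes V: "finite V" "0 \<le> t" "t \<le> card V" "m \<le> card V"
    and "contraction_sequence d (quotient_trigraph f V E) Hs" "card (big_part t f V) < m"
  shows "\<exists>g. m \<le> card (big_part t g V) \<and> card (big_part t g V) \<le> m + 2 * t \<and>
    (\<forall>x \<in> g ` V. red_degree (quotient_trigraph g V E) x \<le> d)"
  using assms(5,6)
proof (induction Hs arbitrary: f)
  case Nil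
  then show ?case by (simp add: contraction_sequence_def)
next
  case (Cons G Hs)
  have G: "G = quotient_trigraph f V E" using Cons.prems(1) by (simp add: contraction_sequence_def)
  show ?case
  proof (cases Hs)
    case Nil
    then have "card (f ` V) = 1" using Cons.prems(1) G by (simp add: contraction_sequence_def)
    then obtain x where x: "f ` V = {x}" by (meson card_1_singletonE)
    have "f a = x" if "a \<in> V" for a using x that by blast
    then have "fiber f V (f a) = V" if "a \<in> V" for a using that by (auto simp: fiber_def)
    then have "big_part t f V = V" using V by (auto simp: big_part_def)
    then show ?thesis using Cons.prems(2) V by simp
  next
    case (Cons H Hs')
    have step: "contracts_to ((G # Hs) ! i) ((G # Hs) ! Suc i)" if "Suc i < length (G # Hs)" for i
      using Cons.prems(1) that unfolding contraction_sequence_def by blast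
    from step[of 0] have "contracts_to G H" using Cons by simp
    then obtain u v w where uvw: "u \<in> f ` V" "v \<in> f ` V" "w \<notin> f ` V" "H = contract u v w G"
      by (auto simp: contracts_to_def G)
    let ?f = "merge_labels u v w f"
    have H: "H = quotient_trigraph ?f V E"
      unfolding uvw(4) G using V(1) uvw(1-3) by (rule contract_quotient)
    have "contracts_to (Hs ! i) (Hs ! Suc i)" if "Suc i < length Hs" for i
      using step[of "Suc i"] that by simp
    then have Hs: "contraction_sequence d (quotient_trigraph ?f V E) Hs"
      using Cons.prems(1) Cons H by (auto simp: contraction_sequence_def)
    show ?thesis
    proof (cases "card (big_part t ?f V) < m")
      case True
      from Cons.IH[OF Hs True] show ?thesis .
    next
      case False
      have "\<forall>x\<in>?f ` V. red_degree (quotient_trigraph ?f V E) x \<le> d"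
        using Hs unfolding contraction_sequence_def by (metis list.set_sel(1) vertices_quotient)
      then show ?thesis
        using False Cons.prems(2) card_big_part_merge[OF V(1) uvw(3) V(2), of u v]
        by (intro exI[of _ ?f]) auto
    qed
  qed
qed

text \<open>Injective renaming of the parts makes it possible to consider only the finitely many labellings
  with labels in \<open>V\<close>.\<close>

lemma
  assumes V: "finite V" and h: "inj_on h (g ` V)" and g': "\<And>a. a \<in> V \<Longrightarrow> g' a = h (g a)"
  shows big_part_relabel: "big_part t g' V = big_part t g V"
    and red_degree_relabel: "x \<in> g ` V \<Longrightarrow>
      red_degree (quotient_trigraph g' V E) (h x) = red_degree (quotient_trigraph g V E) x"
proof -
  have fib: "fiber g' V (h x) = fiber g V x" if "x \<in> g ` V" for x
    unfolding fiber_def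
  proof (intro Collect_cong conj_cong refl)
    fix a assume "a \<in> V"
    then show "g' a = h x \<longleftrightarrow> g a = x"
      using inj_on_eq_iff[OF h _ that, of "g a"] g'[of a] by simp
  qed
  have "fiber g' V (g' a) = fiber g V (g a)" if "a \<in> V" for a
    unfolding g'[OF that] using that by (intro fib imageI)
  then show "big_part t g' V = big_part t g V"
    unfolding big_part_def by (intro Collect_cong conj_cong refl) simp
  have im: "g' ` V = h ` (g ` V)" unfolding image_image by (rule image_cong[OF refl g'])
  assume x: "x \<in> g ` V"
  have cross: "cross g' V (h x) (h y) = cross g V x y" if "y \<in> g ` V" for y
    using fib[OF x] fib[OF that] by (simp add: cross_def)
  have neq: "h y = h x \<longleftrightarrow> y = x" if "y \<in> g ` V" for y using inj_on_eq_iff[OF h that x] .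
  have "{y \<in> g' ` V. y \<noteq> h x \<and> mixed E (cross g' V (h x) y)} =
      h ` {y \<in> g ` V. h y \<noteq> h x \<and> mixed E (cross g' V (h x) (h y))}"
    unfolding im by auto
  also have "{y \<in> g ` V. h y \<noteq> h x \<and> mixed E (cross g' V (h x) (h y))} =
      {y \<in> g ` V. y \<noteq> x \<and> mixed E (cross g V x y)}"
    by (intro Collect_cong conj_cong refl) (simp_all add: cross neq)
  finally have "{y \<in> g' ` V. y \<noteq> h x \<and> mixed E (cross g' V (h x) y)} =
      h ` {y \<in> g ` V. y \<noteq> x \<and> mixed E (cross g V x y)}" .
  moreover have "inj_on h {y \<in> g ` V. y \<noteq> x \<and> mixed E (cross g V x y)}"
    using h by (rule inj_on_subset) auto
  moreover have "h x \<in> g' ` V" using x im by auto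
  ultimately show "red_degree (quotient_trigraph g' V E) (h x) = red_degree (quotient_trigraph g V E) x"
    using x V by (simp add: red_degree_quotient card_image)
qed

lemma tww_balanced_quotient:
  fixes t m :: real
  assumes V: "finite V" and E: "E \<subseteq> pairs_on V" and t: "1 < t" "t \<le> card V"
    and m: "0 < m" "m \<le> card V"
  shows "\<exists>g \<in> V \<rightarrow>\<^sub>E V. m \<le> card (big_part t g V) \<and> card (big_part t g V) \<le> m + 2 * t \<and>
    (\<forall>x \<in> g ` V. red_degree (quotient_trigraph g V E) x \<le> tww (V, E))"
proof -
  have "V \<noteq> {}" using t by auto
  then have "\<exists>d Hs. contraction_sequence d (quotient_trigraph id V E) Hs"
    using V by (intro contraction_sequence_exists is_trigraph_quotient) auto
  then have "\<exists>Hs. contraction_sequence (tww (V, E)) (quotient_trigraph id V E) Hs"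
    unfolding tww_def tww_trigraph_def trigraph_of_eq_quotient[OF V E] by (rule LeastI_ex)
  then obtain Hs where Hs: "contraction_sequence (tww (V, E)) (quotient_trigraph id V E) Hs" by blast
  have "fiber id V a = {a}" if "a \<in> V" for a using that by (auto simp: fiber_def)
  then have "big_part t id V = {}" using t by (auto simp: big_part_def)
  then have "\<exists>g. m \<le> card (big_part t g V) \<and> card (big_part t g V) \<le> m + 2 * t \<and>
    (\<forall>x \<in> g ` V. red_degree (quotient_trigraph g V E) x \<le> tww (V, E))"
    using V t m Hs by (intro contraction_sequence_balanced_quotient) auto
  then obtain g where g: "m \<le> card (big_part t g V)" "card (big_part t g V) \<le> m + 2 * t"
    "\<forall>x \<in> g ` V. red_degree (quotient_trigraph g V E) x \<le> tww (V, E)" by blast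
  obtain h where h: "inj_on h (g ` V)" "h ` g ` V \<subseteq> V"
    using V card_image_le[OF V, of g] by (meson card_le_inj finite_imageI)
  let ?g = "\<lambda>a\<in>V. h (g a)"
  have "big_part t ?g V = big_part t g V" using V h(1) by (rule big_part_relabel) simp
  moreover have "red_degree (quotient_trigraph ?g V E) x \<le> tww (V, E)" if "x \<in> ?g ` V" for x
  proof -
    from that obtain a where "x = ?g a" "a \<in> V" by (rule imageE)
    then have "a \<in> V" "x = h (g a)" by simp_all
    then show ?thesis
      using red_degree_relabel[OF V h(1), of ?g "g a" E] g(3) by simp
  qed
  moreover have "?g \<in> V \<rightarrow>\<^sub>E V" using h(2) by auto
  ultimately show ?thesis using g(1,2) by metis
qed

section \<open>Independent coins\<close>

text \<open>The locality hypothesis makes \<open>F j\<close> a function of the coordinates in \<open>K j\<close>, and independent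
  coordinates stay independent when they are grouped into disjoint blocks.\<close>

lemma expectation_prod_disjoint_blocks:
  fixes F :: "'j \<Rightarrow> ('a \<Rightarrow> 'b :: countable) \<Rightarrow> real"
  assumes I: "finite I" and L: "finite L" and K: "\<And>j. j \<in> L \<Longrightarrow> K j \<subseteq> I"
    and disj: "disjoint_family_on K L"
    and local: "\<And>j X. j \<in> L \<Longrightarrow> F j (restrict X (K j)) = F j X"
    and int: "\<And>j. j \<in> L \<Longrightarrow> integrable (measure_pmf (Pi_pmf I d p)) (F j)"
  shows "measure_pmf.expectation (Pi_pmf I d p) (\<lambda>X. \<Prod>j\<in>L. F j X) =
    (\<Prod>j\<in>L. measure_pmf.expectation (Pi_pmf I d p) (F j))"
proof -
  let ?M = "measure_pmf (Pi_pmf I d p)"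
  have "prob_space.indep_vars ?M (\<lambda>j. PiM (K j) (\<lambda>_. count_space UNIV))
      (\<lambda>j X. restrict (\<lambda>i. X i) (K j)) L"
    using prob_space.indep_vars_restrict[OF measure_pmf.prob_space_axioms indep_vars_Pi_pmf[OF I] K disj] .
  then have "prob_space.indep_vars ?M (\<lambda>_. borel) (\<lambda>j X. F j (restrict (\<lambda>i. X i) (K j))) L"
  proof (rule prob_space.indep_vars_compose2[OF measure_pmf.prob_space_axioms])
    fix j assume j: "j \<in> L"
    have "finite (K j)" using K[OF j] I by (rule finite_subset)
    then have "PiM (K j) (\<lambda>_. count_space (UNIV :: 'b set)) = count_space (PiE (K j) (\<lambda>_. UNIV))"
      by (intro count_space_PiM_finite) auto
    then show "F j \<in> PiM (K j) (\<lambda>_. count_space UNIV) \<rightarrow>\<^sub>M borel" by simp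
  qed
  also have "?this \<longleftrightarrow> prob_space.indep_vars ?M (\<lambda>_. borel) F L"
    using local by (intro prob_space.indep_vars_cong[OF measure_pmf.prob_space_axioms]) auto
  finally show ?thesis using L int by (intro prob_space.indep_vars_lebesgue_integral[OF measure_pmf.prob_space_axioms])
qed

abbreviation coins :: "'a set \<Rightarrow> real \<Rightarrow> ('a \<Rightarrow> bool) pmf" where
  "coins I p \<equiv> Pi_pmf I False (\<lambda>_. bernoulli_pmf p)"

lemma prob_coins_constant:
  assumes I: "finite I" and C: "C \<subseteq> I" and p: "0 \<le> p" "p \<le> 1"
  shows "measure_pmf.prob (coins I p) {X. \<forall>e\<in>C. X e} = p ^ card C"
    and "measure_pmf.prob (coins I p) {X. \<forall>e\<in>C. \<not> X e} = (1 - p) ^ card C"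
proof -
  have *: "measure_pmf.prob (coins I p) {X. \<forall>e\<in>C. X e = b} =
      (measure_pmf.prob (bernoulli_pmf p) {b}) ^ card C" for b
  proof -
    have sub: "{e \<in> I. e \<in> C} = C" using C by blast
    have "{X. \<forall>e\<in>C. X e = b} = Pi I (\<lambda>e. if e \<in> C then {b} else UNIV)"
      using C by (auto simp: Pi_def)
    then have "measure_pmf.prob (coins I p) {X. \<forall>e\<in>C. X e = b} =
        (\<Prod>e\<in>I. if e \<in> C then measure_pmf.prob (bernoulli_pmf p) {b} else 1)"
      using I by (auto simp: measure_Pi_pmf_Pi intro!: prod.cong)
    also have "\<dots> = (\<Prod>e\<in>C. measure_pmf.prob (bernoulli_pmf p) {b})"
      using prod.inter_filter[OF I, of "\<lambda>_. measure_pmf.prob (bernoulli_pmf p) {b}" "\<lambda>e. e \<in> C"]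
      by (simp add: sub)
    finally show ?thesis by simp
  qed
  show "measure_pmf.prob (coins I p) {X. \<forall>e\<in>C. X e} = p ^ card C"
    using *[of True] p by (simp add: measure_pmf_single)
  show "measure_pmf.prob (coins I p) {X. \<forall>e\<in>C. \<not> X e} = (1 - p) ^ card C"
    using *[of False] p by (simp add: measure_pmf_single)
qed

text \<open>The left-hand side is the probability that \<open>k\<close> coins agree. It is 1 for \<open>k = 1\<close>, whatever \<open>p\<close> is,
  which is why the bound starts at 2.\<close>

lemma power_sum_le_exp:
  fixes p :: real
  assumes p: "0 \<le> p" "p \<le> 1 / 2" and k: "2 \<le> k"
  shows "p ^ k + (1 - p) ^ k \<le> exp (- (p * k / 2))"
  using k
proof (induction k rule: dec_induct)
  case base
  have "p\<^sup>2 + (1 - p)\<^sup>2 = 1 - p - p * (1 - 2 * p)" by (simp add: power2_eq_square algebra_simps)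
  also have "\<dots> \<le> 1 + - p" using p by simp
  also have "\<dots> \<le> exp (- p)" by (rule exp_ge_add_one_self)
  finally show ?case by simp
next
  case (step k)
  have "p ^ Suc k + (1 - p) ^ Suc k \<le> (1 - p) * (p ^ k + (1 - p) ^ k)"
    using p mult_right_mono[of p "1 - p" "p ^ k"] by (simp add: algebra_simps)
  also have "\<dots> \<le> exp (- p / 2) * exp (- (p * k / 2))"
  proof (intro mult_mono step.IH)
    show "1 - p \<le> exp (- p / 2)" using exp_ge_add_one_self[of "- p / 2"] p by linarith
  qed (use p in auto)
  also have "\<dots> = exp (- (p * Suc k / 2))"
    unfolding exp_add[symmetric] by (simp add: field_simps)
  finally show ?case .
qed

lemma prob_not_mixed_le:
  fixes p :: real
  assumes I: "finite I" and C: "C \<subseteq> I" "2 \<le> card C" and p: "0 \<le> p" "p \<le> 1 / 2"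
  shows "measure_pmf.prob (coins I p) {X. \<not> mixed {e \<in> I. X e} C} \<le> exp (- (p * card C / 2))"
proof -
  have "{X. \<not> mixed {e \<in> I. X e} C} = {X. \<forall>e\<in>C. X e} \<union> {X. \<forall>e\<in>C. \<not> X e}"
    using C by (auto simp: mixed_def)
  then have "measure_pmf.prob (coins I p) {X. \<not> mixed {e \<in> I. X e} C} \<le> p ^ card C + (1 - p) ^ card C"
    using measure_Un_le[of "{X. \<forall>e\<in>C. X e}" "coins I p" "{X. \<forall>e\<in>C. \<not> X e}"] I C p
    by (simp add: prob_coins_constant)
  then show ?thesis using power_sum_le_exp[OF p C(2)] by linarith
qed

text \<open>The factor that one pair of parts contributes to the exponential moment. The penalty \<open>l\<close> has to grow
  with the number of coins: when the pairs are almost surely mixed, the expectation is close to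
  \<open>exp (- l)\<close>, and a fixed \<open>l\<close> would not give exponential decay in \<open>card C\<close>.\<close>

lemma expectation_mixed_penalty:
  fixes p l :: real
  assumes I: "finite I" and C: "C \<subseteq> I" "2 \<le> card C" and p: "0 \<le> p" "p \<le> 1 / 2"
    and l: "2 \<le> l" "p * card C / 2 \<le> l"
  shows "measure_pmf.expectation (coins I p) (\<lambda>X. exp (- l * of_bool (mixed {e \<in> I. X e} C)))
    \<le> exp (- (p * card C / 4))"
proof -
  let ?A = "{X. \<not> mixed {e \<in> I. X e} C}"
  \<comment> \<open>With \<open>s\<close> the claimed bound, the probability of agreement is at most \<open>s * s\<close>, and
    \<open>exp (- l)\<close> is at most \<open>s / 2\<close>.\<close>
  define s where "s = exp (- (p * card C / 4))"
  have s: "0 < s" "s \<le> 1" using p by (auto simp: s_def)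
  have s2: "exp (- (p * card C / 2)) = s * s" by (simp add: s_def exp_add[symmetric])
  have "(\<lambda>X. exp (- l * of_bool (mixed {e \<in> I. X e} C))) =
      (\<lambda>X. exp (- l) + (1 - exp (- l)) * indicator ?A X)"
    by (auto simp: fun_eq_iff)
  then have "measure_pmf.expectation (coins I p) (\<lambda>X. exp (- l * of_bool (mixed {e \<in> I. X e} C))) =
      exp (- l) + (1 - exp (- l)) * measure_pmf.prob (coins I p) ?A"
    by (simp add: measure_pmf.emeasure_eq_measure)
  also have "\<dots> \<le> exp (- l) + (1 - exp (- l)) * (s * s)"
    using prob_not_mixed_le[OF I C p] l s2 by (intro add_left_mono mult_left_mono) auto
  also have "\<dots> = s * s + exp (- l) * ((1 + s) * (1 - s))" by (simp add: algebra_simps)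
  also have "\<dots> \<le> s * s + s * (1 - s)"
  proof -
    have half: "exp (- l / 2) \<le> 1 / 2"
    proof -
      have "2 \<le> exp (1 :: real)" using exp_ge_add_one_self[of 1] by simp
      also have "\<dots> \<le> exp (l / 2)" using l by simp
      finally show ?thesis by (simp add: exp_minus field_simps)
    qed
    have "exp (- l / 2) \<le> s" using l by (simp add: s_def)
    then have "exp (- l / 2) * exp (- l / 2) \<le> 1 / 2 * s" using half by (intro mult_mono) auto
    then have "exp (- l) \<le> s / 2" by (simp add: exp_add[symmetric])
    moreover have "exp (- l) * (1 + s) \<le> exp (- l) * 2" using s by (intro mult_left_mono) auto
    ultimately have "exp (- l) * (1 + s) \<le> s" by linarith
    then have "exp (- l) * (1 + s) * (1 - s) \<le> s * (1 - s)" using s by (intro mult_right_mono) auto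
    then show ?thesis by (simp add: mult.assoc)
  qed
  also have "\<dots> = s" by (simp add: algebra_simps)
  finally show ?thesis by (simp add: s_def)
qed

section \<open>Union bound over partitions\<close>

lemma finite_pairs_on: "finite V \<Longrightarrow> finite (pairs_on V)"
  by (simp add: pairs_on_def)

lemma cross_subset_pairs_on: "x \<noteq> y \<Longrightarrow> cross g V x y \<subseteq> pairs_on V"
  by (auto simp: cross_def fiber_def pairs_on_def card_insert_if)

lemma card_cross:
  assumes "x \<noteq> y"
  shows "card (cross g V x y) = card (fiber g V x) * card (fiber g V y)"
proof -
  have "cross g V x y = (\<lambda>(a, b). {a, b}) ` (fiber g V x \<times> fiber g V y)"
    by (auto simp: cross_def)
  moreover have "inj_on (\<lambda>(a, b). {a, b}) (fiber g V x \<times> fiber g V y)"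
    using assms by (auto simp: inj_on_def fiber_def doubleton_eq_iff)
  ultimately show ?thesis by (simp add: card_image card_cartesian_product)
qed

lemma disjoint_cross:
  assumes "B \<inter> S = {}"
  shows "disjoint_family_on (\<lambda>(x, y). cross g V x y) (B \<times> S)"
  using assms unfolding disjoint_family_on_def
  by (auto simp: cross_def fiber_def doubleton_eq_iff)

text \<open>A Chernoff bound with a separate weight \<open>l x\<close> for each part \<open>x\<close>. The families of pairs between \<open>x\<close> in
  \<open>B\<close> and \<open>y\<close> in \<open>S\<close> are disjoint for distinct \<open>(x, y)\<close>, so the exponential moment factorizes.\<close>

lemma prob_few_mixed:
  fixes g :: "nat \<Rightarrow> nat" and V and l :: "nat \<Rightarrow> real" and D :: real
  defines "s \<equiv> \<lambda>x. card (fiber g V x)"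
  assumes V: "finite V" and fin: "finite B" "finite S" and BS: "B \<inter> S = {}"
    and p: "0 \<le> p" "p \<le> 1 / 2"
    and s: "\<And>x y. x \<in> B \<Longrightarrow> y \<in> S \<Longrightarrow> 2 \<le> s x * s y"
    and l: "\<And>x. x \<in> B \<Longrightarrow> 2 \<le> l x"
      "\<And>x y. x \<in> B \<Longrightarrow> y \<in> S \<Longrightarrow> p * (real (s x) * real (s y)) / 2 \<le> l x"
  shows "measure_pmf.prob (coins (pairs_on V) p)
      {X. \<forall>x\<in>B. card {y \<in> S. mixed {e \<in> pairs_on V. X e} (cross g V x y)} \<le> D}
    \<le> exp (\<Sum>x\<in>B. l x * D - p * s x / 4 * (\<Sum>y\<in>S. s y))"
proof -
  define I where "I = pairs_on V"
  have I: "finite I" using V by (simp add: I_def finite_pairs_on)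
  define M where "M = coins I p"
  define F where "F = (\<lambda>(x, y) X. exp (- l x * of_bool (mixed {e \<in> I. X e} (cross g V x y))))"
  define Y where "Y = (\<lambda>X x. card {y \<in> S. mixed {e \<in> I. X e} (cross g V x y)})"
  have finM: "finite (set_pmf M)" unfolding M_def
    using I by (intro finite_subset[OF set_Pi_pmf_subset'] finite_PiE_dflt) auto
  have int: "integrable (measure_pmf M) f" for f :: "_ \<Rightarrow> real"
    using finM by (rule integrable_measure_pmf_finite)
  have ne: "x \<noteq> y" if "x \<in> B" "y \<in> S" for x y using BS that by auto
  have prod: "(\<Prod>j\<in>B\<times>S. F j X) = exp (- (\<Sum>x\<in>B. l x * Y X x))" for X
  proof -
    have "(\<Prod>j\<in>B\<times>S. F j X) =
        exp (\<Sum>x\<in>B. \<Sum>y\<in>S. - l x * of_bool (mixed {e \<in> I. X e} (cross g V x y)))"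
      using fin by (simp add: F_def prod.Sigma[symmetric] exp_sum sum.cartesian_product split_def)
    also have "(\<Sum>x\<in>B. \<Sum>y\<in>S. - l x * of_bool (mixed {e \<in> I. X e} (cross g V x y))) =
        - (\<Sum>x\<in>B. l x * Y X x)"
      using fin unfolding Y_def
      by (simp add: sum_distrib_left[symmetric] sum_negf of_bool_def sum.If_cases Int_def)
    finally show ?thesis .
  qed
  have "measure_pmf.expectation M (\<lambda>X. \<Prod>j\<in>B\<times>S. F j X) =
      (\<Prod>j\<in>B\<times>S. measure_pmf.expectation M (F j))"
    unfolding M_def
  proof (rule expectation_prod_disjoint_blocks)
    show "disjoint_family_on (\<lambda>(x, y). cross g V x y) (B \<times> S)" using BS by (rule disjoint_cross)
    fix j X assume "j \<in> B \<times> S"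
    then obtain x y where j: "j = (x, y)" "x \<noteq> y" using ne by blast
    have "cross g V x y \<subseteq> I" using j(2) unfolding I_def by (rule cross_subset_pairs_on)
    then have "mixed {e \<in> I. restrict X (cross g V x y) e} (cross g V x y) =
        mixed {e \<in> I. X e} (cross g V x y)"
      by (auto simp: mixed_def subset_iff)
    then show "F j (restrict X (case j of (x, y) \<Rightarrow> cross g V x y)) = F j X"
      by (simp add: F_def j)
  next
    fix j assume "j \<in> B \<times> S"
    then obtain x y where j: "j = (x, y)" "x \<noteq> y" using ne by blast
    then show "(case j of (x, y) \<Rightarrow> cross g V x y) \<subseteq> I"
      using cross_subset_pairs_on[OF j(2), of g V] by (simp add: I_def)
  qed (use I fin int in \<open>simp_all add: M_def\<close>)
  also have "\<dots> \<le> (\<Prod>(x, y)\<in>B\<times>S. exp (- (p * (s x * s y) / 4)))"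
  proof (intro prod_mono, clarify, intro conjI)
    fix x y assume xy: "x \<in> B" "y \<in> S"
    show "0 \<le> measure_pmf.expectation M (F (x, y))" by (simp add: F_def)
    have "card (cross g V x y) = s x * s y" using ne[OF xy] by (simp add: card_cross s_def)
    then show "measure_pmf.expectation M (F (x, y)) \<le> exp (- (p * (s x * s y) / 4))"
      using expectation_mixed_penalty[OF I, of "cross g V x y" p "l x"] s[OF xy] l(1)[OF xy(1)]
        l(2)[OF xy] p cross_subset_pairs_on[OF ne[OF xy], of g V]
      by (simp add: F_def M_def I_def)
  qed
  also have "\<dots> = exp (- (\<Sum>x\<in>B. p * s x / 4 * (\<Sum>y\<in>S. s y)))"
    using fin by (simp add: prod.Sigma[symmetric] exp_sum[symmetric] sum_distrib_left sum_negf sum_divide_distrib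
        mult_ac)
  finally have expect: "measure_pmf.expectation M (\<lambda>X. \<Prod>j\<in>B\<times>S. F j X) \<le>
      exp (- (\<Sum>x\<in>B. p * s x / 4 * (\<Sum>y\<in>S. s y)))" .
  have "measure_pmf.prob M {X. \<forall>x\<in>B. Y X x \<le> D} \<le>
      measure_pmf.prob M {X. exp (- (\<Sum>x\<in>B. l x * D)) \<le> (\<Prod>j\<in>B\<times>S. F j X)}"
  proof (intro measure_pmf.finite_measure_mono subsetI)
    fix X assume X: "X \<in> {X. \<forall>x\<in>B. Y X x \<le> D}"
    have "(\<Sum>x\<in>B. l x * Y X x) \<le> (\<Sum>x\<in>B. l x * D)"
      using X l(1) by (intro sum_mono mult_left_mono) force+
    then show "X \<in> {X. exp (- (\<Sum>x\<in>B. l x * D)) \<le> (\<Prod>j\<in>B\<times>S. F j X)}"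
      by (simp add: prod)
  qed auto
  also have "\<dots> \<le> measure_pmf.expectation M (\<lambda>X. \<Prod>j\<in>B\<times>S. F j X) / exp (- (\<Sum>x\<in>B. l x * D))"
    using integral_Markov_inequality_measure[of "measure_pmf M" "\<lambda>X. \<Prod>j\<in>B\<times>S. F j X" UNIV
        "exp (- (\<Sum>x\<in>B. l x * D))"] int by (simp add: prod)
  also have "\<dots> \<le> exp (- (\<Sum>x\<in>B. p * s x / 4 * (\<Sum>y\<in>S. s y))) / exp (- (\<Sum>x\<in>B. l x * D))"
    using expect by (rule divide_right_mono) simp
  also have "\<dots> = exp (\<Sum>x\<in>B. l x * D - p * s x / 4 * (\<Sum>y\<in>S. s y))"
    unfolding exp_diff[symmetric] sum_subtractf by simp
  finally show ?thesis by (simp only: M_def Y_def I_def of_nat_sum)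
qed

lemma sum_card_fibers:
  assumes V: "finite V" and A: "A \<subseteq> g ` V"
  shows "(\<Sum>x\<in>A. card (fiber g V x)) = card {a \<in> V. g a \<in> A}"
proof -
  have "card (\<Union>x\<in>A. fiber g V x) = (\<Sum>x\<in>A. card (fiber g V x))"
    using V finite_subset[OF A] by (intro card_UN_disjoint) (auto simp: fiber_def)
  moreover have "(\<Union>x\<in>A. fiber g V x) = {a \<in> V. g a \<in> A}" by (auto simp: fiber_def)
  ultimately show ?thesis by simp
qed

text \<open>With weights \<open>l x = 2 p a t\<close> for a big part \<open>x\<close> of size \<open>a\<close>, where \<open>p t t = 1\<close>, the hypotheses of the
  Chernoff bound hold because \<open>a \<ge> t\<close> and small parts are smaller than \<open>t\<close>. Both the loss \<open>l x D\<close> and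
  the gain from \<open>x\<close> are then proportional to \<open>a\<close>, and the gain is at least twice the loss.\<close>

lemma prob_quotient_low_red_degree:
  fixes p :: real and V :: "nat set"
  defines "n \<equiv> card V" and "t \<equiv> 1 / sqrt p"
  assumes V: "finite V" and p: "0 < p" "p \<le> 1 / 2" and t: "8 * t \<le> n"
    and M: "n / 4 \<le> card (big_part t g V)" "card (big_part t g V) \<le> n / 4 + 2 * t"
  shows "measure_pmf.prob (coins (pairs_on V) p)
      {X. \<forall>x \<in> g ` V. red_degree (quotient_trigraph g V {e \<in> pairs_on V. X e}) x \<le> n * sqrt p / 32}
    \<le> exp (- (p * (real n)\<^sup>2 / 64))"
proof -
  define s where "s = (\<lambda>x. card (fiber g V x))"
  define B where "B = {x \<in> g ` V. t \<le> s x}"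
  define S where "S = {x \<in> g ` V. s x < t}"
  define D where "D = n * sqrt p / 32"
  define M where "M = card (big_part t g V)"
  have fin: "finite B" "finite S" using V by (auto simp: B_def S_def)
  have sub: "B \<subseteq> g ` V" "S \<subseteq> g ` V" by (auto simp: B_def S_def)
  have BS: "B \<inter> S = {}" by (auto simp: B_def S_def)
  have t0: "0 < t" using p by (simp add: t_def)
  have tt: "p * t * t = 1" using p by (simp add: t_def)
  \<comment> \<open>The constant 32 makes the loss at most half of the gain: the small parts cover at least
    \<open>n / 2\<close>, so the gain per vertex is at least \<open>p n / 8\<close>, and the loss per vertex is \<open>2 p t D = p n / 16\<close>.\<close>
  have tD: "t * D = n / 32" using p by (simp add: t_def D_def)
  have t1: "1 < t" using p by (simp add: t_def real_sqrt_lt_1_iff)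
  have sumB: "(\<Sum>x\<in>B. s x) = M"
    unfolding s_def sum_card_fibers[OF V sub(1)] M_def
    by (rule arg_cong[where f = card]) (auto simp: B_def big_part_def s_def)
  have "M + (\<Sum>x\<in>S. s x) = (\<Sum>x\<in>B \<union> S. s x)"
    using fin BS by (simp add: sum.union_disjoint sumB)
  also have "\<dots> = n"
  proof -
    have "{a \<in> V. g a \<in> B \<union> S} = V" by (auto simp: B_def S_def)
    then show ?thesis using sub unfolding s_def by (subst sum_card_fibers[OF V]) (auto simp: n_def)
  qed
  finally have sumS: "real M + (\<Sum>x\<in>S. real (s x)) = n" by (metis of_nat_add of_nat_sum)
  have "{X. \<forall>x \<in> g ` V. red_degree (quotient_trigraph g V {e \<in> pairs_on V. X e}) x \<le> D} \<subseteq>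
      {X. \<forall>x\<in>B. card {y \<in> S. mixed {e \<in> pairs_on V. X e} (cross g V x y)} \<le> D}"
  proof (intro subsetI, simp only: mem_Collect_eq, intro ballI)
    fix X x assume X: "\<forall>x \<in> g ` V. red_degree (quotient_trigraph g V {e \<in> pairs_on V. X e}) x \<le> D"
      and x: "x \<in> B"
    have xV: "x \<in> g ` V" using x sub by blast
    have "card {y \<in> S. mixed {e \<in> pairs_on V. X e} (cross g V x y)} \<le>
        card {y \<in> g ` V. y \<noteq> x \<and> mixed {e \<in> pairs_on V. X e} (cross g V x y)}"
      using V x sub BS by (intro card_mono) auto
    also have "\<dots> = red_degree (quotient_trigraph g V {e \<in> pairs_on V. X e}) x"
      using xV V by (simp add: red_degree_quotient)
    finally show "card {y \<in> S. mixed {e \<in> pairs_on V. X e} (cross g V x y)} \<le> D"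
      using X xV by force
  qed
  then have "measure_pmf.prob (coins (pairs_on V) p)
      {X. \<forall>x \<in> g ` V. red_degree (quotient_trigraph g V {e \<in> pairs_on V. X e}) x \<le> D} \<le>
    measure_pmf.prob (coins (pairs_on V) p)
      {X. \<forall>x\<in>B. card {y \<in> S. mixed {e \<in> pairs_on V. X e} (cross g V x y)} \<le> D}"
    by (intro measure_pmf.finite_measure_mono) auto
  also have "\<dots> \<le> exp (\<Sum>x\<in>B. 2 * p * s x * t * D - p * s x / 4 * (\<Sum>y\<in>S. real (s y)))"
    unfolding s_def
  proof (rule prob_few_mixed[OF V fin BS])
    fix x assume "x \<in> B"
    then have sx: "t \<le> s x" by (simp add: B_def)
    have "p * t * t \<le> p * t * s x" using sx p t0 by (intro mult_left_mono) auto
    then show "2 \<le> 2 * p * card (fiber g V x) * t" using tt by (simp add: s_def mult_ac)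
    fix y assume "y \<in> S"
    then have sy: "s y < t" "y \<in> g ` V" by (auto simp: S_def)
    have "fiber g V y \<noteq> {}" using sy(2) by (auto simp: fiber_def)
    then have "0 < s y" using V by (auto simp: s_def fiber_def card_gt_0_iff)
    \<comment> \<open>Sizes are integers and \<open>t\<close> exceeds 1 because \<open>p\<close> is below 1.\<close>
    moreover have "2 \<le> s x" using sx t1 by linarith
    ultimately have "2 * 1 \<le> s x * s y" by (intro mult_le_mono) auto
    then show "2 \<le> card (fiber g V x) * card (fiber g V y)" by (simp add: s_def)
    have "p * s x * s y \<le> p * s x * t" using sy p by (intro mult_left_mono) auto
    moreover have "0 \<le> p * s x * t" using p t0 by simp
    ultimately show "p * (real (card (fiber g V x)) * real (card (fiber g V y))) / 2 \<le> 2 * p * card (fiber g V x) * t"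
      by (simp add: s_def mult_ac)
  qed (use p in auto)
  also have "(\<Sum>x\<in>B. 2 * p * s x * t * D - p * s x / 4 * (\<Sum>y\<in>S. real (s y))) =
      (\<Sum>x\<in>B. s x * (p * (2 * (t * D) - (\<Sum>y\<in>S. real (s y)) / 4)))"
    by (intro sum.cong refl) (simp add: algebra_simps)
  also have "\<dots> = M * (p * (2 * (t * D) - (\<Sum>y\<in>S. real (s y)) / 4))"
    by (simp add: sum_distrib_right[symmetric] sumB[symmetric])
  also have "\<dots> \<le> - (p * (real n)\<^sup>2 / 64)"
  proof -
    have "n / 16 \<le> (\<Sum>y\<in>S. real (s y)) / 4 - 2 * (t * D)"
      using sumS M t unfolding tD M_def by linarith
    then have "(n / 4) * (p * (n / 16)) \<le> M * (p * ((\<Sum>y\<in>S. real (s y)) / 4 - 2 * (t * D)))"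
      using M p unfolding M_def by (intro mult_mono) auto
    then show ?thesis by (simp add: algebra_simps power2_eq_square)
  qed
  finally show ?thesis by (simp add: D_def)
qed

text \<open>The union bound over the at most \<open>n ^ n\<close> labellings whose big parts cover about a quarter of the
  vertices; by the stopping argument one of them witnesses a small twin-width.\<close>

lemma prob_tww_small:
  fixes p :: real
  assumes n: "n > 0" and p: "0 < p" "p \<le> 1 / 2" and t: "8 / sqrt p \<le> n"
  shows "measure_pmf.prob (coins (pairs_on {1..n}) p)
      {X. tww ({1..n}, {e \<in> pairs_on {1..n}. X e}) < n * sqrt p / 32}
    \<le> real n ^ n * exp (- (p * (real n)\<^sup>2 / 64))"
proof -
  let ?V = "{1..n}" and ?E = "\<lambda>X. {e \<in> pairs_on {1..n}. X e}" and ?t = "1 / sqrt p"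
  let ?P = "measure_pmf.prob (coins (pairs_on {1..n}) p)"
  define \<G> where "\<G> = {g \<in> ?V \<rightarrow>\<^sub>E ?V. n / 4 \<le> card (big_part ?t g ?V) \<and>
    card (big_part ?t g ?V) \<le> n / 4 + 2 * ?t}"
  define A where "A = (\<lambda>g. {X. \<forall>x \<in> g ` ?V. red_degree (quotient_trigraph g ?V (?E X)) x \<le> n * sqrt p / 32})"
  have finPi: "finite (?V \<rightarrow>\<^sub>E ?V)" by (intro finite_PiE) auto
  then have fin: "finite \<G>" by (simp add: \<G>_def)
  have t1: "1 < ?t" using p by simp
  have "{X. tww (?V, ?E X) < n * sqrt p / 32} \<subseteq> (\<Union>g\<in>\<G>. A g)"
  proof
    fix X assume X: "X \<in> {X. tww (?V, ?E X) < n * sqrt p / 32}"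
    have "\<exists>g \<in> ?V \<rightarrow>\<^sub>E ?V. real n / 4 \<le> card (big_part ?t g ?V) \<and>
        card (big_part ?t g ?V) \<le> real n / 4 + 2 * ?t \<and>
        (\<forall>x \<in> g ` ?V. red_degree (quotient_trigraph g ?V (?E X)) x \<le> tww (?V, ?E X))"
      using t1 t n by (intro tww_balanced_quotient) auto
    then obtain g where "g \<in> \<G>"
      "\<forall>x \<in> g ` ?V. red_degree (quotient_trigraph g ?V (?E X)) x \<le> tww (?V, ?E X)"
      by (auto simp: \<G>_def)
    then have "X \<in> A g" using X by (force simp: A_def)
    then show "X \<in> (\<Union>g\<in>\<G>. A g)" using \<open>g \<in> \<G>\<close> by blast
  qed
  then have "?P {X. tww (?V, ?E X) < n * sqrt p / 32} \<le> ?P (\<Union>g\<in>\<G>. A g)"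
    by (intro measure_pmf.finite_measure_mono) auto
  also have "\<dots> \<le> (\<Sum>g\<in>\<G>. ?P (A g))"
    using fin by (intro measure_pmf.finite_measure_subadditive_finite) auto
  also have "\<dots> \<le> (\<Sum>g\<in>\<G>. exp (- (p * (real n)\<^sup>2 / 64)))"
  proof (rule sum_mono)
    fix g assume g: "g \<in> \<G>"
    show "?P (A g) \<le> exp (- (p * (real n)\<^sup>2 / 64))"
      using prob_quotient_low_red_degree[of ?V p g] g p t by (simp add: A_def \<G>_def)
  qed
  also have "\<dots> = card \<G> * exp (- (p * (real n)\<^sup>2 / 64))" by simp
  also have "\<dots> \<le> real n ^ n * exp (- (p * (real n)\<^sup>2 / 64))"
  proof -
    have "card \<G> \<le> card (?V \<rightarrow>\<^sub>E ?V)" using finPi by (intro card_mono) (auto simp: \<G>_def)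
    also have "\<dots> = n ^ n" by (simp add: card_PiE)
    finally have "real (card \<G>) \<le> real n ^ n" by (metis of_nat_le_iff of_nat_power)
    then show ?thesis by (intro mult_right_mono) auto
  qed
  finally show ?thesis .
qed

section \<open>Degrees in the random graph\<close>

text \<open>The exponential moment with parameter 1: one coin contributes \<open>1 + (exp 1 - 1) p\<close>, which is at most
  \<open>exp (2 p)\<close>.\<close>

lemma prob_many_coins:
  fixes p K :: real
  assumes I: "finite I" and C: "C \<subseteq> I" and p: "0 \<le> p" "p \<le> 1"
  shows "measure_pmf.prob (coins I p) {X. K \<le> card {e \<in> C. X e}} \<le> exp (2 * p * card C - K)"
proof -
  define M where "M = coins I p"
  have finM: "finite (set_pmf M)" unfolding M_def
    using I by (intro finite_subset[OF set_Pi_pmf_subset'] finite_PiE_dflt) auto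
  have int: "integrable (measure_pmf M) f" for f :: "_ \<Rightarrow> real"
    using finM by (rule integrable_measure_pmf_finite)
  have sub: "{e \<in> I. e \<in> C} = C" "finite C" using C I finite_subset by auto
  have prod: "exp (real (card {e \<in> C. X e})) = (\<Prod>e\<in>I. if e \<in> C \<and> X e then exp 1 else 1)" for X
  proof -
    have eq: "{e \<in> I. e \<in> C \<and> X e} = {e \<in> C. X e}" using C by blast
    have "(\<Prod>e\<in>I. if e \<in> C \<and> X e then exp 1 else 1 :: real) = (\<Prod>e\<in>{e \<in> C. X e}. exp 1)"
      using prod.inter_filter[OF I, of "\<lambda>_. exp 1 :: real" "\<lambda>e. e \<in> C \<and> X e"]
      by (simp add: eq)
    then show ?thesis by (simp add: exp_of_nat_mult[symmetric])
  qed
  have "measure_pmf.expectation M (\<lambda>X. exp (real (card {e \<in> C. X e}))) =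
      (\<Prod>e\<in>I. measure_pmf.expectation (bernoulli_pmf p) (\<lambda>b. if e \<in> C \<and> b then exp 1 else 1))"
    unfolding prod M_def using I
    by (intro expectation_prod_Pi_pmf) (auto intro: integrable_measure_pmf_finite)
  also have "\<dots> = (\<Prod>e\<in>I. if e \<in> C then p * exp 1 + (1 - p) else 1)"
    using p by (intro prod.cong) auto
  also have "\<dots> = (p * exp 1 + (1 - p)) ^ card C"
    using prod.inter_filter[OF I, of "\<lambda>_. p * exp 1 + (1 - p)" "\<lambda>e. e \<in> C"] by (simp add: sub)
  also have "\<dots> \<le> exp (2 * p) ^ card C"
  proof (intro power_mono)
    have "p * exp 1 \<le> p * 3" using p exp_le by (intro mult_left_mono) auto
    then show "p * exp 1 + (1 - p) \<le> exp (2 * p)"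
      using exp_ge_add_one_self[of "2 * p"] by linarith
  qed (use p in auto)
  also have "\<dots> = exp (2 * p * card C)" by (simp add: exp_of_nat_mult[symmetric] mult_ac)
  finally have expect: "measure_pmf.expectation M (\<lambda>X. exp (real (card {e \<in> C. X e}))) \<le>
      exp (2 * p * card C)" .
  have "measure_pmf.prob M {X. K \<le> card {e \<in> C. X e}} =
      measure_pmf.prob M {X. exp K \<le> exp (real (card {e \<in> C. X e}))}" by simp
  also have "\<dots> \<le> measure_pmf.expectation M (\<lambda>X. exp (real (card {e \<in> C. X e}))) / exp K"
    using integral_Markov_inequality_measure[of "measure_pmf M"
        "\<lambda>X. exp (real (card {e \<in> C. X e}))" UNIV "exp K"] int by simp
  also have "\<dots> \<le> exp (2 * p * card C) / exp K" using expect by (rule divide_right_mono) simp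
  finally show ?thesis by (simp only: M_def exp_diff)
qed

lemma prob_large_degree:
  fixes p :: real
  assumes p: "0 \<le> p" "p \<le> 1"
  shows "measure_pmf.prob (coins (pairs_on {1..n}) p)
      {X. \<exists>a\<in>{1..n}. 4 * real n * p < card {e \<in> {e \<in> pairs_on {1..n}. X e}. a \<in> e}}
    \<le> n * exp (- (2 * real n * p))"
proof -
  let ?I = "pairs_on {1..n}"
  let ?A = "\<lambda>a. {X. 4 * real n * p \<le> card {e \<in> {e \<in> ?I. a \<in> e}. X e}}"
  have I: "finite ?I" by (simp add: finite_pairs_on)
  have "measure_pmf.prob (coins ?I p) (?A a) \<le> exp (- (2 * real n * p))" if a: "a \<in> {1..n}" for a
  proof -
    have "{e \<in> ?I. a \<in> e} \<subseteq> (\<lambda>b. {a, b}) ` {1..n}"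
      by (auto simp: pairs_on_def card_2_iff)
    then have "card {e \<in> ?I. a \<in> e} \<le> card ((\<lambda>b. {a, b}) ` {1..n})"
      by (intro card_mono) auto
    also have "\<dots> \<le> n" using card_image_le[of "{1..n}" "\<lambda>b. {a, b}"] by simp
    finally have "card {e \<in> ?I. a \<in> e} \<le> n" .
    then have "2 * p * card {e \<in> ?I. a \<in> e} \<le> 2 * p * n" using p by (intro mult_left_mono) auto
    then have "exp (2 * p * card {e \<in> ?I. a \<in> e} - 4 * real n * p) \<le> exp (- (2 * real n * p))"
      by (simp add: mult_ac)
    then show ?thesis
      using order_trans[OF prob_many_coins[OF I, of "{e \<in> ?I. a \<in> e}" p "4 * real n * p"]] p by blast
  qed
  then have "(\<Sum>a\<in>{1..n}. measure_pmf.prob (coins ?I p) (?A a)) \<le> (\<Sum>a\<in>{1..n}. exp (- (2 * real n * p)))"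
    by (intro sum_mono)
  moreover have "measure_pmf.prob (coins ?I p) (\<Union>a\<in>{1..n}. ?A a) \<le>
      (\<Sum>a\<in>{1..n}. measure_pmf.prob (coins ?I p) (?A a))"
    by (intro measure_pmf.finite_measure_subadditive_finite) auto
  moreover have "measure_pmf.prob (coins ?I p)
      {X. \<exists>a\<in>{1..n}. 4 * real n * p < card {e \<in> {e \<in> ?I. X e}. a \<in> e}} \<le>
      measure_pmf.prob (coins ?I p) (\<Union>a\<in>{1..n}. ?A a)"
  proof (intro measure_pmf.finite_measure_mono subsetI)
    fix X assume "X \<in> {X. \<exists>a\<in>{1..n}. 4 * real n * p < card {e \<in> {e \<in> ?I. X e}. a \<in> e}}"
    then obtain a where a: "a \<in> {1..n}" and less: "4 * real n * p < card {e \<in> {e \<in> ?I. X e}. a \<in> e}"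
      by blast
    have "{e \<in> {e \<in> ?I. X e}. a \<in> e} = {e \<in> {e \<in> ?I. a \<in> e}. X e}" by blast
    then have "X \<in> ?A a" using less by simp
    then show "X \<in> (\<Union>a\<in>{1..n}. ?A a)" using a by (rule UN_I[rotated])
  qed auto
  ultimately show ?thesis by simp
qed

text \<open>Groups of size \<open>s\<close> about \<open>1 / sqrt p\<close> balance the two terms \<open>s (4 n p)\<close> and \<open>n / s\<close>.\<close>

lemma tww_le_of_degree_np:
  fixes p :: real
  assumes n: "n > 0" and p: "0 < p" "p \<le> 1" and E: "E \<subseteq> pairs_on {1..n}"
    and deg: "\<And>a. a \<in> {1..n} \<Longrightarrow> card {e \<in> E. a \<in> e} \<le> 4 * real n * p"
  shows "tww ({1..n}, E) \<le> 8 * real n * sqrt p"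
proof -
  define t where "t = 1 / sqrt p"
  define s where "s = nat \<lceil>t\<rceil>"
  have t: "1 \<le> t" using p by (simp add: t_def)
  have s: "t \<le> s" "s \<le> 2 * t" "s > 0" using t by (auto simp: s_def) linarith+
  have pp: "p = sqrt p * sqrt p" using p by simp
  have tww: "tww ({1..n}, E) \<le> max (s * nat \<lfloor>4 * real n * p\<rfloor>) (n div s)"
    using n s E deg by (intro tww_le_of_max_degree) (auto simp: le_nat_floor)
  have "s * nat \<lfloor>4 * real n * p\<rfloor> \<le> (2 * t) * (4 * real n * p)"
    using s t p unfolding of_nat_mult by (intro mult_mono) auto
  also have "\<dots> = 8 * real n * sqrt p" using p pp by (simp add: t_def field_simps)
  finally have "s * nat \<lfloor>4 * real n * p\<rfloor> \<le> 8 * real n * sqrt p" .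
  moreover have "n div s \<le> 8 * real n * sqrt p"
  proof -
    have "real (n div s) \<le> n / s" by (rule of_nat_div_le_of_nat)
    also have "\<dots> \<le> n / t" using s t by (intro divide_left_mono) auto
    also have "\<dots> \<le> 8 * real n * sqrt p" using p by (simp add: t_def)
    finally show ?thesis .
  qed
  ultimately show ?thesis using tww by (smt (verit) max_def of_nat_le_iff)
qed

section \<open>Twin-width of the random graph\<close>

text \<open>Each of the two bad events has probability at most \<open>1 / n\<close>. For a small twin-width this needs
  \<open>n ln n - p n^2 / 64 \<le> - ln n\<close>, which follows from \<open>n p \<ge> 726 ln n\<close> because 726 is more than \<open>2 * 64\<close>.\<close>

lemma prob_tww_gnp:
  fixes p :: real
  assumes n: "n \<ge> 3" and p: "726 * ln n / n \<le> p" "p \<le> 1 / 2"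
  shows "1 - 2 / n \<le> measure_pmf.prob (gnp n p)
    {G. 1 / 32 * n * sqrt p \<le> tww G \<and> tww G \<le> 8 * real n * sqrt p}"
proof -
  let ?V = "{1..n}" and ?E = "\<lambda>X. {e \<in> pairs_on {1..n}. X e}"
  let ?P = "measure_pmf.prob (coins (pairs_on {1..n}) p)"
  define low where "low = {X. tww (?V, ?E X) < n * sqrt p / 32}"
  define high where "high = {X. \<exists>a\<in>?V. 4 * real n * p < card {e \<in> ?E X. a \<in> e}}"
  have ln: "1 \<le> ln n"
  proof -
    have "exp 1 \<le> real n" using n exp_le by linarith
    then show ?thesis using n by (simp add: ln_ge_iff)
  qed
  have np: "726 * ln n \<le> n * p" using p n by (simp add: field_simps)
  then have p0: "0 < p" using ln n by (smt (verit) mult_nonneg_nonpos of_nat_0_le_iff)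
  have t: "8 / sqrt p \<le> n"
  proof -
    have "64 * 1 \<le> (n * p) * n" using np ln n by (intro mult_mono) auto
    also have "(n * p) * n = (n * sqrt p)\<^sup>2"
      using p0 by (simp add: power_mult_distrib power2_eq_square)
    finally have "8\<^sup>2 \<le> (n * sqrt p)\<^sup>2" by simp
    then have "8 \<le> n * sqrt p" by (rule power2_le_imp_le) (use p0 in simp)
    then show ?thesis using p0 by (simp add: field_simps)
  qed
  have "?P low \<le> real n ^ n * exp (- (p * (real n)\<^sup>2 / 64))"
    unfolding low_def using n p0 p t by (intro prob_tww_small) auto
  also have "\<dots> = exp (n * ln n - n * (n * p) / 64)"
  proof -
    have "real n ^ n = exp (n * ln n)" using n by (simp add: exp_of_nat_mult)
    then show ?thesis by (simp add: exp_add[symmetric] power2_eq_square mult_ac)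
  qed
  also have "\<dots> \<le> exp (- ln n)"
  proof -
    have "n * (726 * ln n) \<le> n * (n * p)" using np by (intro mult_left_mono) auto
    then have "726 * (n * ln n) \<le> n * (n * p)" by simp
    moreover have "1 * ln n \<le> n * ln n" using n ln by (intro mult_right_mono) auto
    ultimately have "n * ln n - n * (n * p) / 64 \<le> - ln n" using ln by linarith
    then show ?thesis by simp
  qed
  also have "\<dots> = 1 / n" using n by (simp add: exp_minus divide_inverse)
  finally have low: "?P low \<le> 1 / n" .
  have "?P high \<le> n * exp (- (2 * real n * p))"
    unfolding high_def using p0 p by (intro prob_large_degree) auto
  also have "\<dots> = exp (ln n - 2 * (n * p))" using n by (simp add: exp_diff exp_minus divide_inverse)
  also have "\<dots> \<le> exp (- ln n)" using np ln by simp
  also have "\<dots> = 1 / n" using n by (simp add: exp_minus divide_inverse)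
  finally have high: "?P high \<le> 1 / n" .
  have "1 - 2 / n \<le> 1 - ?P (low \<union> high)"
    using low high measure_Un_le[of low "coins (pairs_on {1..n}) p" high] by simp
  also have "\<dots> = ?P (- (low \<union> high))"
    using measure_pmf.prob_compl[of "low \<union> high" "coins (pairs_on {1..n}) p"]
    by (simp add: Compl_eq_Diff_UNIV)
  also have "\<dots> \<le> ?P {X. 1 / 32 * n * sqrt p \<le> tww (?V, ?E X) \<and> tww (?V, ?E X) \<le> 8 * real n * sqrt p}"
  proof (intro measure_pmf.finite_measure_mono subsetI)
    fix X assume "X \<in> - (low \<union> high)"
    then have "n * sqrt p / 32 \<le> tww (?V, ?E X)"
      and deg: "\<And>a. a \<in> ?V \<Longrightarrow> card {e \<in> ?E X. a \<in> e} \<le> 4 * real n * p"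
      by (auto simp: low_def high_def not_less)
    moreover have "tww (?V, ?E X) \<le> 8 * real n * sqrt p"
      using n p0 p deg by (intro tww_le_of_degree_np) auto
    ultimately show "X \<in> {X. 1 / 32 * n * sqrt p \<le> tww (?V, ?E X) \<and> tww (?V, ?E X) \<le> 8 * real n * sqrt p}"
      by simp
  qed auto
  finally show ?thesis by (simp add: gnp_def vimage_def)
qed

theorem theorem1p2:
  fixes p :: "nat \<Rightarrow> real"
  assumes "eventually (\<lambda>n. 726 * ln (real n) / real n \<le> p n \<and> p n \<le> 1 / 2) sequentially"
  shows "\<exists>c1 c2 :: real. 0 < c1 \<and> c1 \<le> c2 \<and>
    (\<lambda>n. measure_pmf.prob (gnp n (p n))
       {G. c1 * real n * sqrt (p n) \<le> real (tww G) \<and>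
           real (tww G) \<le> c2 * real n * sqrt (p n)}) \<longlonglongrightarrow> 1"
proof (intro exI conjI)
  show "0 < (1 / 32 :: real)" "1 / 32 \<le> (8 :: real)" by simp_all
  show "(\<lambda>n. measure_pmf.prob (gnp n (p n))
       {G. 1 / 32 * real n * sqrt (p n) \<le> real (tww G) \<and>
           real (tww G) \<le> 8 * real n * sqrt (p n)}) \<longlonglongrightarrow> 1"
  proof (rule real_tendsto_sandwich)
    show "eventually (\<lambda>n. 1 - 2 / real n \<le> measure_pmf.prob (gnp n (p n))
       {G. 1 / 32 * real n * sqrt (p n) \<le> real (tww G) \<and>
           real (tww G) \<le> 8 * real n * sqrt (p n)}) sequentially"
      using assms eventually_ge_at_top[of 3]
      by eventually_elim (rule prob_tww_gnp, auto)
    show "(\<lambda>n. 1 - 2 / real n) \<longlonglongrightarrow> 1"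
      using tendsto_diff[OF tendsto_const lim_const_over_n[of 2], of 1] by simp
    show "(\<lambda>n. 1 :: real) \<longlonglongrightarrow> 1" by (rule tendsto_const)
  qed simp
qed

end
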